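(* For any integers $d\geq 2$ and $n\geq 2$, the directed wrapped butterfly $WB(d,n)$ satisfies: 1. $Z(WB(d,n))=(d-1)d^{n-1}n$; 2. $M(WB(d,n))=(d-1)d^{n-1}n$; 3. $\mathrm{mr}(WB(d,n))=d^{n-1}n$; 4. $\gamma_P(WB(d,n))=(d-1)d^{n-2}n$.
   Context: Directed wrapped butterfly: $WB(d,n)=L^{n-1}(K_d\otimes C_n)$, where $K_d$ is the complete symmetric digraph of order $d$ with a loop on each vertex (all ordered pairs are arcs), $C_n$ is the directed cycle of order $n$, and the conjunction $G\otimes H$ has vertex set $V(G)\times V(H)$ with an arc from $(g,h)$ to $(g',h')$ exactly when $(g,g')\in A(G)$ and $(h,h')\in A(H)$. The line digraph $L(G)$ has vertex set $\{uv:(u,v)\in A(G)\}$, with an arc from $uv$ to $xy$ exactly when $v=x$; $L^0(G)=G$, $L^r(G)=L(L^{r-1}(G))$. A digraph $H$ has vertex set $V(H)$ and arc set $A(H)\subseteq V(H)\times V(H)$; loops are allowed. $N^+_H(v)=\{u:(v,u)\in A(H)\}$, $N^+_H[v]=N^+_H(v)\cup\{v\}$, $N^+_H[S]=\bigcup_{v\in S}N^+_H[v]$. Zero forcing in a digraph $H$: for non-empty $S\subseteq V(H)$ put $B^0(S)=S$ and, for $i\ge 0$: if $H$ has no loops, $B^{i+1}(S)=B^i(S)\cup\{v\in V(H)\setminus B^i(S):\exists u\in B^i(S),\ N^+_H(u)\setminus B^i(S)=\{v\}\}$; if $H$ has at least one loop, $B^{i+1}(S)=B^i(S)\cup\{v\in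 V(H)\setminus B^i(S):\exists u\in V(H),\ N^+_H(u)\setminus B^i(S)=\{v\}\}$. $S$ is a zero forcing set if $B^m(S)=V(H)$ for some $m\ge 0$. $Z(H)$ is the minimum cardinality of a zero forcing set of $H$. Power domination in $H$: for non-empty $S\subseteq V(H)$ put $P^0(S)=S$, $P^1(S)=N^+_H[S]$, and for $i\geq 1$ obtain $P^{i+1}(S)$ from $P^i(S)$ by the same rule by which $B^{i+1}(S)$ is obtained from $B^i(S)$ (the loopless rule if $H$ has no loops, the other rule if $H$ has at least one loop). $S$ is a power dominating set if $P^t(S)=V(H)$ for some $t\ge 0$. $\gamma_P(H)$ is the minimum cardinality of a power dominating set of $H$. Maximum nullity and minimum rank: for a digraph $H$ of order $p$, let $\mathcal S(H)$ be the set of real $p\times p$ matrices $X$ such that: if $H$ has no loops, for all $i\neq j$, $X_{i,j}\neq 0\Leftrightarrow (i,j)\in A(H)$ (diagonal arbitrary); if $H$ has at least one loop, for all $i,j$, $X_{i,j}\neq 0\Leftrightarrow (i,j)\in A(H)$. $M(H)=\max\{\dim\ker X:X\in\mathcal S(H)\}$ and $\mathrm{mr}(H)=\min\{\operatorname{rank}X:X\in\mathcal S(H)\}$. *)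

theory Defs
  imports
    "Graph_Theory.Pair_Digraph"
    "Jordan_Normal_Form.Matrix_Kernel"
    "Jordan_Normal_Form.DL_Rank"
begin

text \<open>
  Digraphs are the records \<open>pair_pre_digraph\<close>: a vertex set \<open>pverts\<close> and a set \<open>parcs\<close> of ordered
  pairs, loops allowed.
\<close>

definition has_loop :: "'a pair_pre_digraph \<Rightarrow> bool" where
  "has_loop H \<longleftrightarrow> (\<exists>v \<in> pverts H. (v, v) \<in> parcs H)"

definition out_nbrs :: "'a pair_pre_digraph \<Rightarrow> 'a \<Rightarrow> 'a set" where
  "out_nbrs H v = {u. (v, u) \<in> parcs H}"

definition closed_out_nbrs :: "'a pair_pre_digraph \<Rightarrow> 'a set \<Rightarrow> 'a set" where
  "closed_out_nbrs H S = (\<Union>v \<in> S. out_nbrs H v \<union> {v})"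


section \<open>Iterated line digraphs and the wrapped butterfly\<close>

text \<open>
  A vertex of the line digraph of \<open>G\<close> is an arc of \<open>G\<close>, so its natural type is \<open>'a \<times> 'a\<close>.
  The type \<open>'a node\<close> is closed under forming such (formal) pairs, which allows the construction to
  be iterated: \<open>Arc u v\<close> is the vertex $uv$.
\<close>

datatype 'a node = Base 'a | Arc "'a node" "'a node"

definition embed_digraph :: "'a pair_pre_digraph \<Rightarrow> 'a node pair_pre_digraph" where
  "embed_digraph G =
     \<lparr> pverts = Base ` pverts G,
       parcs = {(Base u, Base v) | u v. (u, v) \<in> parcs G} \<rparr>"

definition line_digraph :: "'a node pair_pre_digraph \<Rightarrow> 'a node pair_pre_digraph" where
  "line_digraph G =
     \<lparr> pverts = {Arc u v | u v. (u, v) \<in> parcs G},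
       parcs = {(Arc u v, Arc x y) | u v x y.
                  (u, v) \<in> parcs G \<and> (x, y) \<in> parcs G \<and> v = x} \<rparr>"

definition conjunction :: "'a pair_pre_digraph \<Rightarrow> 'b pair_pre_digraph \<Rightarrow> ('a \<times> 'b) pair_pre_digraph"
  where
  "conjunction G H =
     \<lparr> pverts = pverts G \<times> pverts H,
       parcs = {((g, h), (g', h')) | g h g' h'. (g, g') \<in> parcs G \<and> (h, h') \<in> parcs H} \<rparr>"

definition complete_looped_digraph :: "nat \<Rightarrow> nat pair_pre_digraph" where
  "complete_looped_digraph d = \<lparr> pverts = {..<d}, parcs = {..<d} \<times> {..<d} \<rparr>"

definition directed_cycle :: "nat \<Rightarrow> nat pair_pre_digraph" where
  "directed_cycle n = \<lparr> pverts = {..<n}, parcs = {(i, (i + 1) mod n) | i. i < n} \<rparr>"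

definition wrapped_butterfly :: "nat \<Rightarrow> nat \<Rightarrow> (nat \<times> nat) node pair_pre_digraph" where
  "wrapped_butterfly d n =
     (line_digraph ^^ (n - 1))
       (embed_digraph (conjunction (complete_looped_digraph d) (directed_cycle n)))"


section \<open>Zero forcing and power domination\<close>

definition force_step :: "'a pair_pre_digraph \<Rightarrow> 'a set \<Rightarrow> 'a set" where
  "force_step H B =
     (if has_loop H
      then B \<union> {v \<in> pverts H - B. \<exists>u \<in> pverts H. out_nbrs H u - B = {v}}
      else B \<union> {v \<in> pverts H - B. \<exists>u \<in> B. out_nbrs H u - B = {v}})"

primrec forced :: "'a pair_pre_digraph \<Rightarrow> 'a set \<Rightarrow> nat \<Rightarrow> 'a set" where
  "forced H S 0 = S"
| "forced H S (Suc i) = force_step H (forced H S i)"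

definition zero_forcing_set :: "'a pair_pre_digraph \<Rightarrow> 'a set \<Rightarrow> bool" where
  "zero_forcing_set H S \<longleftrightarrow>
     S \<noteq> {} \<and> S \<subseteq> pverts H \<and> (\<exists>m. forced H S m = pverts H)"

definition zero_forcing_number :: "'a pair_pre_digraph \<Rightarrow> nat" where
  "zero_forcing_number H = Min {card S | S. zero_forcing_set H S}"

primrec monitored :: "'a pair_pre_digraph \<Rightarrow> 'a set \<Rightarrow> nat \<Rightarrow> 'a set" where
  "monitored H S 0 = S"
| "monitored H S (Suc i) =
     (if i = 0 then closed_out_nbrs H S else force_step H (monitored H S i))"

definition power_dominating_set :: "'a pair_pre_digraph \<Rightarrow> 'a set \<Rightarrow> bool" where
  "power_dominating_set H S \<longleftrightarrow>
     S \<noteq> {} \<and> S \<subseteq> pverts H \<and> (\<exists>t. monitored H S t = pverts H)"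

definition power_domination_number :: "'a pair_pre_digraph \<Rightarrow> nat" where
  "power_domination_number H = Min {card S | S. power_dominating_set H S}"


section \<open>Maximum nullity and minimum rank\<close>

text \<open>
  Matrices are indexed by \<open>0, \<dots>, p - 1\<close>, so the vertices have to be numbered. For finite \<open>H\<close> such
  a bijection exists; a different choice permutes rows and columns simultaneously, which
  does not affect ranks and nullities.
\<close>

definition vertex_numbering :: "'a pair_pre_digraph \<Rightarrow> nat \<Rightarrow> 'a" where
  "vertex_numbering H = (SOME f. bij_betw f {0..<card (pverts H)} (pverts H))"

definition digraph_matrices :: "'a pair_pre_digraph \<Rightarrow> real mat set" where
  "digraph_matrices H =
     (let p = card (pverts H); f = vertex_numbering H in
      {X \<in> carrier_mat p p. \<forall>i < p. \<forall>j < p.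
         has_loop H \<or> i \<noteq> j \<longrightarrow> (X $$ (i, j) \<noteq> 0 \<longleftrightarrow> (f i, f j) \<in> parcs H)})"

definition max_nullity :: "'a pair_pre_digraph \<Rightarrow> nat" where
  "max_nullity H = Max (kernel_dim ` digraph_matrices H)"

definition min_rank :: "'a pair_pre_digraph \<Rightarrow> nat" where
  "min_rank H = Min (vec_space.rank (card (pverts H)) ` digraph_matrices H)"

end

theory Submission
  imports Defs
begin

text \<open>
  For \<open>n \<ge> 2\<close> the wrapped butterfly is the line digraph \<open>H\<close> of \<open>G = L\<^sup>n\<^sup>-\<^sup>2(K\<^sub>d \<otimes> C\<^sub>n)\<close>, a loopless
  digraph with \<open>d\<^sup>n\<^sup>-\<^sup>1 n\<close> vertices, all of in- and out-degree \<open>d\<close>. The vertices of \<open>H\<close> are the arcs of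
  \<open>G\<close>; they fall into \<open>card (pverts G)\<close> classes of size \<open>d\<close> according to their tails. The arcs of one
  class are twins: they have the same in-neighbours in \<open>H\<close>, namely the arcs entering their tail, and the
  out-neighbourhood in \<open>H\<close> of an arc is exactly one class, the one belonging to its head. All four
  parameters follow from this.

  Zero forcing. A vertex of \<open>H\<close> can only be forced if its twins are already coloured, so a zero forcing
  set omits at most one arc of each class (\<open>zero_forcing_set_line_digraph_ge\<close>). Omitting the arcs of a
  one-factor of \<open>G\<close> attains this (\<open>zero_forcing_set_of_one_factor\<close>). So the zero forcing number is
  \<open>(d - 1) * card (pverts G)\<close>.

  Rank and nullity. Every zero forcing set \<open>S\<close> bounds the nullity of the matrices described by \<open>H\<close> by
  \<open>card S\<close>, because a kernel vector vanishing on \<open>S\<close> vanishes altogether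
  (\<open>kernel_vector_vanishes_on_forced\<close>). Conversely the adjacency matrix of \<open>H\<close> has only one column per
  class, hence rank at most \<open>card (pverts G)\<close> (\<open>low_rank_matrix_line_digraph\<close>), and the two bounds add up to
  the order of \<open>H\<close> (\<open>min_rank_and_max_nullity_eqI\<close>).

  Power domination. For a vertex \<open>v\<close> of \<open>G\<close>, either some arc of \<open>S\<close> enters \<open>v\<close>, or \<open>S\<close> contains \<open>d - 1\<close> of
  the arcs leaving \<open>v\<close>. Counting gives \<open>(d - 1) * card (pverts G) \<le> d * card S\<close>
  (\<open>power_dominating_set_line_digraph_ge\<close>). For equality one wants a set \<open>U\<close> of vertices of \<open>G\<close> such
  that every vertex of \<open>G\<close> has exactly one in-neighbour in \<open>U\<close> and every vertex of \<open>U\<close> exactly one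
  out-neighbour in \<open>U\<close>; then the arcs from \<open>U\<close> to its complement form an optimal set
  (\<open>power_dominating_set_of_cyclic_perfect\<close>). For \<open>n = 2\<close> such a \<open>U\<close> is a copy of \<open>C\<^sub>n\<close> in
  \<open>K\<^sub>d \<otimes> C\<^sub>n\<close>; for \<open>n \<ge> 3\<close> the digraph \<open>G\<close> is itself a line digraph, and the arcs of a one-factor of the
  digraph before it will do.

  As for the one-factors, \<open>K\<^sub>d \<otimes> C\<^sub>n\<close> has one because it contains \<open>d\<close> disjoint copies of \<open>C\<^sub>n\<close>, and the line digraph of any \<open>d\<close>-diregular digraph has one: at each vertex
  the \<open>d\<close> entering arcs can be matched with the \<open>d\<close> leaving arcs (\<open>one_factor_line_digraph\<close>).
\<close>


section \<open>Rank and nullity\<close>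

text \<open>
  The rank of a square matrix is the dimension of its column space, which is the image of
  \<open>v \<mapsto> A v\<close>; hence this is the rank-nullity theorem for that linear map.
\<close>

lemma rank_plus_kernel_dim:
  fixes A :: "'a::field mat"
  assumes A: "A \<in> carrier_mat n n"
  shows "vec_space.rank n A + kernel_dim A = n"
proof -
  interpret V: vec_space "TYPE('a)" n .
  interpret K: kernel n n A by unfold_locales (rule A)
  interpret T: linear_map class_ring V.V V.V "\<lambda>v. A *\<^sub>v v"
  proof unfold_locales
    show "(\<lambda>v. A *\<^sub>v v) \<in> LinearCombinations.module_hom class_ring V.V V.V"
      using A by (auto simp: LinearCombinations.module_hom_def mult_add_distrib_mat_vec mult_mat_vec)
  qed
  have im: "T.imT = V.span (set (cols A))"
    using V.col_space_eq[OF A] A by (auto simp: T.im_def V.col_space_def)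
  have ker: "T.kerT = mat_kernel A"
    using A by (auto simp: T.ker_def mat_kernel_def)
  have "V.rank A + vectorspace.dim class_ring (V.vs (mat_kernel A)) = V.dim"
    using T.rank_nullity[OF V.fin_dim] unfolding im ker V.rank_def by simp
  thus ?thesis by (simp add: V.dim_is_n)
qed

lemma rank_le_card_cols:
  fixes A :: "'a::field mat"
  assumes A: "A \<in> carrier_mat n nc"
  shows "vec_space.rank n A \<le> card (set (cols A))"
proof -
  interpret V: vec_space "TYPE('a)" n .
  obtain S where S: "maximal S (\<lambda>T. T \<subseteq> set (cols A) \<and> V.lin_indpt T)"
    using maximal_exists[of "\<lambda>T. T \<subseteq> set (cols A) \<and> V.lin_indpt T" "card (set (cols A))" "{}"]
    by (meson List.finite_set V.finite_lin_indpt2 card_mono empty_iff empty_subsetI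
        rev_finite_subset)
  hence "card S \<le> card (set (cols A))" by (simp add: card_mono maximal_def)
  thus ?thesis using V.rank_card_indpt[OF A S] by simp
qed

text \<open>
  If no nonzero kernel vector is supported on \<open>J\<close>, then the columns with index in \<open>J\<close> are linearly
  independent. Columns enter a linear combination as members of a set, so it has to be excluded
  separately that two of them coincide; the difference of two unit vectors would then be a kernel
  vector supported on \<open>J\<close>.
\<close>

lemma card_le_rank_if_supported_kernel_trivial:
  fixes A :: "'a::field mat"
  assumes A: "A \<in> carrier_mat n nc" and J: "J \<subseteq> {..<nc}"
    and triv: "\<And>x j. x \<in> carrier_vec nc \<Longrightarrow> A *\<^sub>v x = 0\<^sub>v n \<Longrightarrow> (\<And>j. j < nc \<Longrightarrow> j \<notin> J \<Longrightarrow> x $ j = 0)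
                 \<Longrightarrow> j \<in> J \<Longrightarrow> x $ j = 0"
  shows "card J \<le> vec_space.rank n A"
proof -
  interpret V: vec_space "TYPE('a)" n .
  have fJ: "finite J" using J finite_subset by blast
  have prod: "(A *\<^sub>v x) $ i = (\<Sum>j\<in>J. A $$ (i, j) * x $ j)"
    if x: "x \<in> carrier_vec nc" "\<And>j. j < nc \<Longrightarrow> j \<notin> J \<Longrightarrow> x $ j = 0" and i: "i < n" for x i
  proof -
    have "(A *\<^sub>v x) $ i = (\<Sum>j\<in>{0..<nc}. A $$ (i, j) * x $ j)"
      using A x i by (simp add: scalar_prod_def)
    also have "\<dots> = (\<Sum>j\<in>J. A $$ (i, j) * x $ j)"
      by (rule sum.mono_neutral_right) (use J x(2) in auto)
    finally show ?thesis .
  qed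
  have inj: "inj_on (col A) J"
  proof (rule inj_onI, rule ccontr)
    fix j k assume jk: "j \<in> J" "k \<in> J" "col A j = col A k" "j \<noteq> k"
    define x :: "'a vec" where "x = vec nc (\<lambda>l. if l = j then 1 else if l = k then - 1 else 0)"
    have x: "x \<in> carrier_vec nc" "\<And>l. l < nc \<Longrightarrow> l \<notin> J \<Longrightarrow> x $ l = 0"
      using jk by (auto simp: x_def)
    have "A *\<^sub>v x = 0\<^sub>v n"
    proof (rule eq_vecI)
      fix i assume "i < dim_vec (0\<^sub>v n :: 'a vec)"
      hence i: "i < n" by simp
      have "(A *\<^sub>v x) $ i = (\<Sum>l\<in>J. A $$ (i, l) * x $ l)" by (rule prod[OF x i])
      also have "\<dots> = (\<Sum>l\<in>{j, k}. A $$ (i, l) * x $ l)"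
        by (rule sum.mono_neutral_right) (use J jk fJ in \<open>auto simp: x_def\<close>)
      finally have "(A *\<^sub>v x) $ i = (\<Sum>l\<in>{j, k}. A $$ (i, l) * x $ l)" .
      moreover have "(\<Sum>l\<in>{j, k}. A $$ (i, l) * x $ l) = A $$ (i, j) - A $$ (i, k)"
        using jk subsetD[OF J jk(1)] subsetD[OF J jk(2)] by (simp add: x_def)
      moreover have "A $$ (i, j) = col A j $ i" "A $$ (i, k) = col A k $ i"
        using A i subsetD[OF J jk(1)] subsetD[OF J jk(2)] by simp_all
      ultimately show "(A *\<^sub>v x) $ i = 0\<^sub>v n $ i" using jk(3) i by (simp only: index_zero_vec) simp
    qed (use A in simp)
    from triv[OF x(1) this x(2) jk(1)] have "x $ j = 0" .
    thus False using jk J by (auto simp: x_def)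
  qed
  let ?U = "col A ` J"
  have U: "?U \<subseteq> set (cols A)" using J A by (auto simp: cols_def)
  have Uc: "?U \<subseteq> carrier_vec n" using A by auto
  have "V.lin_indpt ?U"
  proof
    assume "V.lin_dep ?U"
    then obtain a u where au: "V.lincomb a ?U = 0\<^sub>v n" "u \<in> ?U" "a u \<noteq> 0"
      using V.finite_lin_dep[of ?U] Uc fJ by auto
    define x :: "'a vec" where "x = vec nc (\<lambda>l. if l \<in> J then a (col A l) else 0)"
    have x: "x \<in> carrier_vec nc" "\<And>l. l < nc \<Longrightarrow> l \<notin> J \<Longrightarrow> x $ l = 0"
      by (auto simp: x_def)
    have "A *\<^sub>v x = 0\<^sub>v n"
    proof (rule eq_vecI)
      fix i assume "i < dim_vec (0\<^sub>v n :: 'a vec)"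
      hence i: "i < n" by simp
      have "(A *\<^sub>v x) $ i = (\<Sum>l\<in>J. A $$ (i, l) * x $ l)" by (rule prod[OF x i])
      also have "\<dots> = (\<Sum>l\<in>J. a (col A l) * col A l $ i)"
        using J A i by (intro sum.cong) (auto simp: x_def)
      also have "\<dots> = V.lincomb a ?U $ i"
        using V.lincomb_index[OF i Uc] by (simp add: sum.reindex[OF inj])
      finally show "(A *\<^sub>v x) $ i = 0\<^sub>v n $ i" by (simp add: au)
    qed (use A in simp)
    moreover obtain j where "j \<in> J" "u = col A j" using au(2) by auto
    ultimately have "x $ j = 0" using triv[OF x(1) _ x(2)] by blast
    thus False using au \<open>j \<in> J\<close> \<open>u = col A j\<close> J by (auto simp: x_def)
  qed
  hence "card ?U \<le> V.rank A" using V.rank_ge_card_indpt[OF A U] by simp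
  thus ?thesis by (simp add: card_image[OF inj])
qed


section \<open>Zero forcing sets bound the nullity\<close>

lemma bij_vertex_numbering:
  assumes "finite (pverts H)"
  shows "bij_betw (vertex_numbering H) {0..<card (pverts H)} (pverts H)"
  unfolding vertex_numbering_def
  using someI_ex[OF ex_bij_betw_nat_finite[OF assms]] .

text \<open>
  Zero forcing mimics the solution of \<open>X x = 0\<close>: when \<open>u\<close> forces \<open>w\<close>, the equation of row \<open>u\<close>
  has \<open>x w\<close> as its only term that is not yet known to vanish, and the coefficient of \<open>x w\<close> is
  nonzero. Without loops the diagonal entry of row \<open>u\<close> is arbitrary, which is why \<open>u\<close> itself
  must then already belong to the current set.
\<close>

lemma kernel_vector_vanishes_on_forced:
  fixes x :: "real vec"
  assumes fin: "finite (pverts H)"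
    and X: "X \<in> digraph_matrices H"
    and x: "x \<in> carrier_vec (card (pverts H))" "X *\<^sub>v x = 0\<^sub>v (card (pverts H))"
    and S: "S \<subseteq> pverts H"
    and van: "\<And>j. j < card (pverts H) \<Longrightarrow> vertex_numbering H j \<in> S \<Longrightarrow> x $ j = 0"
  shows "forced H S m \<subseteq> pverts H \<and>
    (\<forall>j < card (pverts H). vertex_numbering H j \<in> forced H S m \<longrightarrow> x $ j = 0)"
proof (induction m)
  case 0
  then show ?case using S van by simp
next
  case (Suc m)
  define p where "p = card (pverts H)"
  define f where "f = vertex_numbering H"
  define B where "B = forced H S m"
  note defs = p_def[symmetric] f_def[symmetric] B_def[symmetric]
  have bij: "bij_betw f {0..<p} (pverts H)"
    using bij_vertex_numbering[OF fin] by (simp add: defs)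
  have inj: "j = k" if "f j = f k" "j < p" "k < p" for j k
    using bij that by (auto simp: bij_betw_def inj_on_def)
  have Xc: "X \<in> carrier_mat p p"
    and Xe: "\<And>i j. i < p \<Longrightarrow> j < p \<Longrightarrow> has_loop H \<or> i \<noteq> j \<Longrightarrow> X $$ (i, j) \<noteq> 0 \<longleftrightarrow> (f i, f j) \<in> parcs H"
    using X unfolding digraph_matrices_def by (auto simp: Let_def defs)
  have B: "B \<subseteq> pverts H" "\<And>j. j < p \<Longrightarrow> f j \<in> B \<Longrightarrow> x $ j = 0"
    using Suc.IH by (auto simp: defs)
  have step: "x $ k = 0" if k: "k < p" and w: "f k \<notin> B" and u: "u \<in> pverts H"
    and rule: "has_loop H \<or> u \<in> B" and out: "out_nbrs H u - B = {f k}" for k u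
  proof -
    obtain i where i: "i < p" "f i = u" using bij u by (force simp: bij_betw_def)
    have other: "X $$ (i, j) * x $ j = 0" if j: "j < p" "j \<noteq> k" for j
    proof (cases "f j \<in> B")
      case True
      thus ?thesis using B(2) j by simp
    next
      case False
      hence "i = j \<Longrightarrow> has_loop H" using rule i by auto
      moreover have "f j \<notin> out_nbrs H u" using False out inj[OF _ j(1) k] j(2) by auto
      ultimately show ?thesis using Xe[OF i(1) j(1)] i(2) by (auto simp: out_nbrs_def)
    qed
    have "X *\<^sub>v x = 0\<^sub>v p" "x \<in> carrier_vec p" using x by (simp_all add: defs)
    hence "0 = (X *\<^sub>v x) $ i" using i by simp
    also have "\<dots> = (\<Sum>j\<in>{0..<p}. X $$ (i, j) * x $ j)"
      using Xc \<open>x \<in> carrier_vec p\<close> i by (simp add: scalar_prod_def)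
    also have "\<dots> = (\<Sum>j\<in>{k}. X $$ (i, j) * x $ j)"
      by (rule sum.mono_neutral_right) (use k other in auto)
    finally have "X $$ (i, k) * x $ k = 0" by simp
    moreover have "f k \<in> out_nbrs H u" using out by auto
    moreover have "has_loop H \<or> i \<noteq> k" using rule i w by auto
    ultimately show ?thesis using Xe[OF i(1) k] i(2) by (auto simp: out_nbrs_def)
  qed
  have "force_step H B \<subseteq> pverts H" using B(1) by (auto simp: force_step_def)
  moreover have "x $ j = 0" if "j < p" "f j \<in> force_step H B" for j
    using that B step by (cases "f j \<in> B") (auto simp: force_step_def split: if_splits)
  ultimately show ?case by (simp add: defs)
qed

text \<open>
  A kernel vector that vanishes on a zero forcing set is zero, so the columns outside the set are
  linearly independent.
\<close>

lemma rank_ge_of_zero_forcing_set: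
  assumes fin: "finite (pverts H)"
    and X: "X \<in> digraph_matrices H"
    and S: "zero_forcing_set H S"
  shows "card (pverts H) \<le> vec_space.rank (card (pverts H)) X + card S"
proof -
  define p where "p = card (pverts H)"
  define f where "f = vertex_numbering H"
  note defs = p_def[symmetric] f_def[symmetric]
  have bij: "bij_betw f {0..<p} (pverts H)"
    using bij_vertex_numbering[OF fin] by (simp add: defs)
  have Xc: "X \<in> carrier_mat p p"
    using X unfolding digraph_matrices_def by (auto simp: Let_def defs)
  obtain m where SV: "S \<subseteq> pverts H" and m: "forced H S m = pverts H"
    using S by (auto simp: zero_forcing_set_def)
  define J where "J = {j \<in> {0..<p}. f j \<notin> S}"
  have "card J \<le> vec_space.rank p X"
  proof (rule card_le_rank_if_supported_kernel_trivial[OF Xc])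
    fix x j assume x: "x \<in> carrier_vec p" "X *\<^sub>v x = 0\<^sub>v p"
      "\<And>j. j < p \<Longrightarrow> j \<notin> J \<Longrightarrow> x $ j = 0" and j: "j \<in> J"
    have "x $ j = 0" if "j < p" "f j \<in> S" for j using x(3)[of j] that by (simp add: J_def)
    with kernel_vector_vanishes_on_forced[OF fin X _ _ SV, of x m] x(1,2)
    have "\<forall>j<p. f j \<in> forced H S m \<longrightarrow> x $ j = 0" by (simp add: defs)
    thus "x $ j = 0" using j bij by (auto simp: m J_def bij_betw_def)
  qed (auto simp: J_def)
  moreover have "card J = p - card S"
  proof -
    have "f ` J = f ` {0..<p} - S" by (auto simp: J_def)
    hence "f ` J = pverts H - S" using bij by (simp add: bij_betw_def)
    moreover have "inj_on f J" using bij by (auto simp: J_def bij_betw_def inj_on_def)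
    ultimately have "card J = card (pverts H - S)" by (metis card_image)
    thus ?thesis using SV fin by (simp add: card_Diff_subset finite_subset p_def)
  qed
  ultimately show ?thesis by (simp add: defs)
qed

text \<open>
  A zero forcing set bounds all ranks from below by the same number \<open>r\<close>; a single matrix of rank at
  most \<open>r\<close> therefore attains the minimum rank and the maximum nullity at once.
\<close>

lemma min_rank_and_max_nullity_eqI:
  assumes fin: "finite (pverts H)"
    and S: "zero_forcing_set H S" and p: "card (pverts H) = card S + r"
    and X: "X \<in> digraph_matrices H" "vec_space.rank (card (pverts H)) X \<le> r"
  shows "min_rank H = r" "max_nullity H = card S"
proof -
  let ?rank = "vec_space.rank (card (pverts H)) :: real mat \<Rightarrow> nat"
  have sum: "?rank Y + kernel_dim Y = card S + r" if "Y \<in> digraph_matrices H" for Y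
    using that rank_plus_kernel_dim[of Y "card (pverts H)"]
    by (auto simp: digraph_matrices_def Let_def p)
  have ge: "r \<le> ?rank Y" if "Y \<in> digraph_matrices H" for Y
    using rank_ge_of_zero_forcing_set[OF fin that S] by (simp add: p)
  have le: "kernel_dim Y \<le> card S" if "Y \<in> digraph_matrices H" for Y
    using sum[OF that] ge[OF that] by linarith
  have "?rank X = r" "kernel_dim X = card S" using X(2) sum[OF X(1)] ge[OF X(1)] by linarith+
  hence mem: "r \<in> ?rank ` digraph_matrices H" "card S \<in> kernel_dim ` digraph_matrices H"
    using X(1) by force+
  have "?rank Y \<le> card S + r" if "Y \<in> digraph_matrices H" for Y using sum[OF that] by linarith
  hence "?rank ` digraph_matrices H \<subseteq> {..card S + r}" by auto
  hence "finite (?rank ` digraph_matrices H)" using finite_subset by blast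
  thus "min_rank H = r" unfolding min_rank_def using mem(1) ge by (intro Min_eqI) auto
  have "kernel_dim ` digraph_matrices H \<subseteq> {..card S}" using le by auto
  hence "finite (kernel_dim ` digraph_matrices H)" using finite_subset by blast
  thus "max_nullity H = card S" unfolding max_nullity_def using mem(2) le by (intro Max_eqI) auto
qed


section \<open>Line digraphs of diregular digraphs\<close>

definition in_nbrs :: "'a pair_pre_digraph \<Rightarrow> 'a \<Rightarrow> 'a set" where
  "in_nbrs H v = {u. (u, v) \<in> parcs H}"

definition diregular :: "nat \<Rightarrow> 'a pair_pre_digraph \<Rightarrow> bool" where
  "diregular d G \<longleftrightarrow> finite (pverts G) \<and> parcs G \<subseteq> pverts G \<times> pverts G \<and>
     (\<forall>v \<in> pverts G. card (out_nbrs G v) = d \<and> card (in_nbrs G v) = d)"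

text \<open>
  On \<open>Base\<close> nodes the values of \<open>arc_tail\<close> and \<open>arc_head\<close> are arbitrary: both functions are only
  applied to vertices of line digraphs.
\<close>

fun arc_tail :: "'a node \<Rightarrow> 'a node" where
  "arc_tail (Arc u v) = u"
| "arc_tail (Base x) = Base x"

fun arc_head :: "'a node \<Rightarrow> 'a node" where
  "arc_head (Arc u v) = v"
| "arc_head (Base x) = Base x"

lemma in_pverts_line_digraph:
  "x \<in> pverts (line_digraph G) \<longleftrightarrow> (\<exists>u v. x = Arc u v \<and> (u, v) \<in> parcs G)"
  by (auto simp: line_digraph_def)

lemma in_parcs_line_digraph:
  "(x, y) \<in> parcs (line_digraph G) \<longleftrightarrow>
     x \<in> pverts (line_digraph G) \<and> y \<in> pverts (line_digraph G) \<and> arc_head x = arc_tail y"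
  by (auto simp: line_digraph_def)

lemma out_nbrs_line_digraph:
  "(u, v) \<in> parcs G \<Longrightarrow> out_nbrs (line_digraph G) (Arc u v) = Arc v ` out_nbrs G v"
  by (auto simp: out_nbrs_def line_digraph_def)

lemma in_nbrs_line_digraph:
  "(u, v) \<in> parcs G \<Longrightarrow> in_nbrs (line_digraph G) (Arc u v) = (\<lambda>x. Arc x u) ` in_nbrs G u"
  by (auto simp: in_nbrs_def line_digraph_def)

lemma has_loop_line_digraph:
  "parcs G \<subseteq> pverts G \<times> pverts G \<Longrightarrow> \<not> has_loop G \<Longrightarrow> \<not> has_loop (line_digraph G)"
  by (auto simp: has_loop_def line_digraph_def)

lemma diregular_wf:
  assumes "diregular d G"
  shows "finite (pverts G)" "parcs G \<subseteq> pverts G \<times> pverts G" "finite (parcs G)"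
    "finite (out_nbrs G v)" "finite (in_nbrs G v)"
proof -
  show 1: "finite (pverts G)" "parcs G \<subseteq> pverts G \<times> pverts G"
    using assms by (auto simp: diregular_def)
  thus "finite (parcs G)" by (meson finite_SigmaI finite_subset)
  have "out_nbrs G v \<subseteq> pverts G" "in_nbrs G v \<subseteq> pverts G"
    using 1(2) by (auto simp: out_nbrs_def in_nbrs_def)
  thus "finite (out_nbrs G v)" "finite (in_nbrs G v)" using 1(1) finite_subset by blast+
qed

lemma card_arcs_with_tail_in:
  assumes G: "diregular d G" and W: "W \<subseteq> pverts G"
  shows "card {x \<in> pverts (line_digraph G). arc_tail x \<in> W} = d * card W"
proof -
  note fin = diregular_wf[OF G]
  have "{x \<in> pverts (line_digraph G). arc_tail x \<in> W} = (\<lambda>(u, v). Arc u v) ` Sigma W (out_nbrs G)"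
    by (auto simp: in_pverts_line_digraph out_nbrs_def image_iff)
  moreover have "inj_on (\<lambda>(u, v). Arc u v) (Sigma W (out_nbrs G))" by (auto simp: inj_on_def)
  ultimately have "card {x \<in> pverts (line_digraph G). arc_tail x \<in> W} = card (Sigma W (out_nbrs G))"
    by (simp add: card_image)
  also have "\<dots> = (\<Sum>u\<in>W. card (out_nbrs G u))"
    using fin(4) finite_subset[OF W fin(1)] by (intro card_SigmaI) auto
  also have "\<dots> = (\<Sum>u\<in>W. d)" using G W by (intro sum.cong) (auto simp: diregular_def)
  finally show ?thesis by simp
qed

lemma card_pverts_line_digraph:
  assumes "diregular d G"
  shows "card (pverts (line_digraph G)) = d * card (pverts G)"
proof -
  have "{x \<in> pverts (line_digraph G). arc_tail x \<in> pverts G} = pverts (line_digraph G)"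
    using diregular_wf(2)[OF assms] by (fastforce simp: in_pverts_line_digraph)
  thus ?thesis using card_arcs_with_tail_in[OF assms subset_refl] by simp
qed

lemma diregular_line_digraph:
  assumes "diregular d G"
  shows "diregular d (line_digraph G)"
  unfolding diregular_def
proof (intro conjI ballI)
  note fin = diregular_wf[OF assms]
  have "pverts (line_digraph G) = (\<lambda>(u, v). Arc u v) ` parcs G"
    by (force simp: in_pverts_line_digraph)
  thus "finite (pverts (line_digraph G))" using fin(3) by simp
  show "parcs (line_digraph G) \<subseteq> pverts (line_digraph G) \<times> pverts (line_digraph G)"
    by (auto simp: in_parcs_line_digraph)
  fix x assume "x \<in> pverts (line_digraph G)"
  then obtain u v where x: "x = Arc u v" "(u, v) \<in> parcs G" by (auto simp: in_pverts_line_digraph)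
  moreover have "u \<in> pverts G" "v \<in> pverts G" using x fin(2) by auto
  moreover have "inj_on (Arc v) A" "inj_on (\<lambda>y. Arc y u) A" for A by (auto simp: inj_on_def)
  ultimately show "card (out_nbrs (line_digraph G) x) = d" "card (in_nbrs (line_digraph G) x) = d"
    using assms by (simp_all add: out_nbrs_line_digraph in_nbrs_line_digraph card_image diregular_def)
qed


section \<open>One-factors\<close>

text \<open>
  A one-factor is a spanning subdigraph with all in- and out-degrees equal to \<open>1\<close>; it is encoded by
  its successor map.
\<close>

definition one_factor :: "'a pair_pre_digraph \<Rightarrow> ('a \<Rightarrow> 'a) \<Rightarrow> bool" where
  "one_factor G \<phi> \<longleftrightarrow> bij_betw \<phi> (pverts G) (pverts G) \<and> (\<forall>v \<in> pverts G. (v, \<phi> v) \<in> parcs G)"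

text \<open>
  In the line digraph, each vertex \<open>v\<close> of \<open>G\<close> gives a complete bipartite set of arcs from the arcs
  entering \<open>v\<close> to the arcs leaving \<open>v\<close>. Both sides have \<open>d\<close> elements, so a bijection \<open>b v\<close> can be
  chosen at each \<open>v\<close> separately, and these bijections together form a one-factor.
\<close>

lemma one_factor_line_digraph:
  assumes G: "diregular d G"
  shows "\<exists>\<psi>. one_factor (line_digraph G) \<psi>"
proof -
  note fin = diregular_wf[OF G]
  have "\<forall>v \<in> pverts G. \<exists>b. bij_betw b (in_nbrs G v) (out_nbrs G v)"
    using G fin by (auto intro!: finite_same_card_bij simp: diregular_def)
  then obtain b where b: "\<And>v. v \<in> pverts G \<Longrightarrow> bij_betw (b v) (in_nbrs G v) (out_nbrs G v)"
    by metis
  define \<psi> where "\<psi> = (\<lambda>x. Arc (arc_head x) (b (arc_head x) (arc_tail x)))"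
  have arc: "(v, b v u) \<in> parcs G" if "(u, v) \<in> parcs G" for u v
    using b[of v] that fin(2) by (auto simp: bij_betw_def in_nbrs_def out_nbrs_def)
  have inj: "inj_on \<psi> (pverts (line_digraph G))"
  proof (rule inj_onI)
    fix x y assume xy: "x \<in> pverts (line_digraph G)" "y \<in> pverts (line_digraph G)" "\<psi> x = \<psi> y"
    then obtain u u' v where "x = Arc u v" "y = Arc u' v" "(u, v) \<in> parcs G" "(u', v) \<in> parcs G"
      "b v u = b v u'" by (auto simp: in_pverts_line_digraph \<psi>_def)
    moreover from this have "v \<in> pverts G" using fin(2) by auto
    ultimately show "x = y" using b[of v] by (auto simp: bij_betw_def inj_on_def in_nbrs_def)
  qed
  have into: "\<psi> ` pverts (line_digraph G) \<subseteq> pverts (line_digraph G)"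
    using arc by (auto simp: in_pverts_line_digraph \<psi>_def)
  have "\<psi> ` pverts (line_digraph G) = pverts (line_digraph G)"
    using diregular_wf(1)[OF diregular_line_digraph[OF G]] into inj by (rule endo_inj_surj)
  hence "bij_betw \<psi> (pverts (line_digraph G)) (pverts (line_digraph G))"
    using inj by (simp add: bij_betw_def)
  moreover have "(x, \<psi> x) \<in> parcs (line_digraph G)" if "x \<in> pverts (line_digraph G)" for x
    using that into by (auto simp: in_parcs_line_digraph \<psi>_def)
  ultimately show ?thesis by (auto simp: one_factor_def)
qed


section \<open>Zero forcing in line digraphs\<close>

text \<open>
  Whatever could force \<open>x\<close> has \<open>y\<close> as a second out-neighbour outside \<open>B\<close>.
\<close>

lemma twins_not_forced:
  assumes "in_nbrs H x = in_nbrs H y" "x \<noteq> y" "x \<notin> B" "y \<notin> B"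
  shows "x \<notin> force_step H B"
proof
  assume "x \<in> force_step H B"
  then obtain u where u: "out_nbrs H u - B = {x}"
    using assms(3) by (auto simp: force_step_def split: if_splits)
  hence "u \<in> in_nbrs H x" by (auto simp: out_nbrs_def in_nbrs_def)
  hence "y \<in> out_nbrs H u - B" using assms by (auto simp: out_nbrs_def in_nbrs_def)
  thus False using u assms(2) by auto
qed

lemma zero_forcing_set_meets_twins:
  assumes S: "zero_forcing_set H S" and tw: "in_nbrs H x = in_nbrs H y" "x \<noteq> y"
    and x: "x \<in> pverts H"
  shows "x \<in> S \<or> y \<in> S"
proof (rule ccontr)
  assume neg: "\<not> (x \<in> S \<or> y \<in> S)"
  have "x \<notin> forced H S m \<and> y \<notin> forced H S m" for m
    by (induction m) (use neg tw twins_not_forced[of H x y] twins_not_forced[of H y x] in auto)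
  thus False using S x by (auto simp: zero_forcing_set_def)
qed

text \<open>
  The domination step is the only chance of two twins outside \<open>S\<close>, and it reaches them exactly when
  \<open>S\<close> contains a common in-neighbour.
\<close>

lemma power_dominating_set_meets_twins:
  assumes S: "power_dominating_set H S" and tw: "in_nbrs H x = in_nbrs H y" "x \<noteq> y"
    and x: "x \<in> pverts H"
  shows "x \<in> S \<or> y \<in> S \<or> in_nbrs H x \<inter> S \<noteq> {}"
proof (rule ccontr)
  assume neg: "\<not> ?thesis"
  have "x \<notin> monitored H S m \<and> y \<notin> monitored H S m" for m
  proof (induction m)
    case (Suc m)
    have "x \<notin> closed_out_nbrs H S \<and> y \<notin> closed_out_nbrs H S"
      using neg tw(1) by (auto simp: closed_out_nbrs_def out_nbrs_def in_nbrs_def)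
    thus ?case using Suc tw twins_not_forced[of H x y] twins_not_forced[of H y x] by simp
  qed (use neg in simp)
  thus False using S x by (auto simp: power_dominating_set_def)
qed

lemma line_digraph_twins:
  assumes "x \<in> pverts (line_digraph G)" "y \<in> pverts (line_digraph G)" "arc_tail x = arc_tail y"
  shows "in_nbrs (line_digraph G) x = in_nbrs (line_digraph G) y"
  using assms by (auto simp: in_nbrs_line_digraph in_pverts_line_digraph)

text \<open>
  Arcs of \<open>G\<close> with the same tail are twins in the line digraph. So a zero forcing set omits at most
  one arc per tail, that is, at most \<open>card (pverts G)\<close> of the \<open>d * card (pverts G)\<close> arcs.
\<close>

lemma zero_forcing_set_line_digraph_ge:
  assumes G: "diregular d G" and S: "zero_forcing_set (line_digraph G) S"
  shows "(d - 1) * card (pverts G) \<le> card S"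
proof -
  let ?H = "line_digraph G"
  note fin = diregular_wf[OF G]
  have SV: "S \<subseteq> pverts ?H" using S by (simp add: zero_forcing_set_def)
  have finH: "finite (pverts ?H)" using diregular_wf(1)[OF diregular_line_digraph[OF G]] .
  have "inj_on arc_tail (pverts ?H - S)"
  proof (intro inj_onI, rule ccontr)
    fix x y assume "x \<in> pverts ?H - S" "y \<in> pverts ?H - S" "arc_tail x = arc_tail y" "x \<noteq> y"
    thus False using zero_forcing_set_meets_twins[OF S line_digraph_twins[of x G y]] by auto
  qed
  moreover have "arc_tail ` (pverts ?H - S) \<subseteq> pverts G"
    using fin(2) by (fastforce simp: in_pverts_line_digraph)
  ultimately have "card (pverts ?H - S) \<le> card (pverts G)"
    using card_inj_on_le fin(1) by blast
  hence "card (pverts ?H) - card S \<le> card (pverts G)"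
    using SV finH by (simp add: card_Diff_subset finite_subset)
  thus ?thesis by (simp add: card_pverts_line_digraph[OF G] diff_mult_distrib)
qed

text \<open>
  Used with properties \<open>P\<close> that only one in-neighbour of \<open>v\<close> can have.
\<close>

lemma in_nbr_other_than:
  assumes G: "diregular d G" and d: "d \<ge> 2" and v: "v \<in> pverts G"
    and un: "\<And>u u'. u \<in> in_nbrs G v \<Longrightarrow> u' \<in> in_nbrs G v \<Longrightarrow> P u \<Longrightarrow> P u' \<Longrightarrow> u = u'"
  obtains w where "(w, v) \<in> parcs G" "w \<in> pverts G" "\<not> P w"
proof -
  have "\<exists>w \<in> in_nbrs G v. \<not> P w"
  proof (rule ccontr)
    assume "\<not> ?thesis"
    hence "card (in_nbrs G v) \<le> 1"
      using un diregular_wf(5)[OF G] by (auto simp: card_le_Suc0_iff_eq)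
    thus False using G d v by (auto simp: diregular_def)
  qed
  thus ?thesis using that diregular_wf(2)[OF G] by (auto simp: in_nbrs_def)
qed

text \<open>
  Omitting one arc per tail is enough if every omitted arc \<open>(v, \<phi> v)\<close> has some in-neighbour
  \<open>(w, v)\<close> in \<open>S\<close>, which then forces it in the first step. For a one-factor the only omitted arc
  entering \<open>v\<close> comes from the preimage of \<open>v\<close> under \<open>\<phi>\<close>, and \<open>d \<ge> 2\<close> leaves another one.
\<close>

lemma zero_forcing_set_of_one_factor:
  assumes G: "diregular d G" and d: "d \<ge> 2" and ne: "pverts G \<noteq> {}" and \<phi>: "one_factor G \<phi>"
    and nl: "\<not> has_loop G"
  defines "S \<equiv> {x \<in> pverts (line_digraph G). arc_head x \<noteq> \<phi> (arc_tail x)}"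
  shows "zero_forcing_set (line_digraph G) S" "card S = (d - 1) * card (pverts G)"
proof -
  let ?H = "line_digraph G"
  note fin = diregular_wf[OF G]
  have finH: "finite (pverts ?H)" using diregular_wf(1)[OF diregular_line_digraph[OF G]] .
  have \<phi>arc: "(v, \<phi> v) \<in> parcs G" if "v \<in> pverts G" for v using \<phi> that by (auto simp: one_factor_def)
  have "pverts ?H - S = (\<lambda>v. Arc v (\<phi> v)) ` pverts G"
    using \<phi>arc fin(2) by (fastforce simp: S_def in_pverts_line_digraph)
  moreover have "inj_on (\<lambda>v. Arc v (\<phi> v)) (pverts G)" by (auto simp: inj_on_def)
  ultimately have "card (pverts ?H - S) = card (pverts G)" by (simp add: card_image)
  moreover have sub: "S \<subseteq> pverts ?H" by (auto simp: S_def)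
  moreover have "card (pverts ?H - S) = card (pverts ?H) - card S"
    using sub finH by (simp add: card_Diff_subset finite_subset)
  moreover have "card S \<le> card (pverts ?H)" using sub finH by (simp add: card_mono)
  ultimately have "card S + card (pverts G) = d * card (pverts G)"
    using card_pverts_line_digraph[OF G] by linarith
  thus card: "card S = (d - 1) * card (pverts G)" by (simp add: diff_mult_distrib)
  hence "card S > 0" using d ne fin(1) by (simp add: card_gt_0_iff)
  hence "S \<noteq> {}" by auto
  moreover have "forced ?H S 1 = pverts ?H"
  proof -
    have "x \<in> force_step ?H S" if x: "x \<in> pverts ?H" "x \<notin> S" for x
    proof -
      obtain v where v: "x = Arc v (\<phi> v)" "(v, \<phi> v) \<in> parcs G"
        using x by (auto simp: S_def in_pverts_line_digraph)
      hence vG: "v \<in> pverts G" using fin(2) by auto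
      have "u = u'" if "u \<in> in_nbrs G v" "u' \<in> in_nbrs G v" "\<phi> u = v" "\<phi> u' = v" for u u'
        using that \<phi> subsetD[OF fin(2)]
        by (fastforce simp: one_factor_def bij_betw_def inj_on_def in_nbrs_def)
      then obtain w where w: "(w, v) \<in> parcs G" "\<phi> w \<noteq> v"
        using in_nbr_other_than[OF G d vG, of "\<lambda>u. \<phi> u = v"] by metis
      have "Arc w v \<in> S" using w by (auto simp: S_def in_pverts_line_digraph)
      moreover have "out_nbrs ?H (Arc w v) - S = {x}"
        unfolding out_nbrs_line_digraph[OF w(1)]
        using v by (auto simp: S_def in_pverts_line_digraph out_nbrs_def)
      ultimately show ?thesis
        using x has_loop_line_digraph[OF fin(2) nl] by (auto simp: force_step_def)
    qed
    thus ?thesis using sub by (auto simp: force_step_def split: if_splits)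
  qed
  ultimately show "zero_forcing_set ?H S" using sub unfolding zero_forcing_set_def by blast
qed

lemma zero_forcing_number_eqI:
  assumes "finite (pverts H)" "zero_forcing_set H S" "card S = k"
    and "\<And>T. zero_forcing_set H T \<Longrightarrow> k \<le> card T"
  shows "zero_forcing_number H = k"
  unfolding zero_forcing_number_def
proof (rule Min_eqI)
  have "{card S |S. zero_forcing_set H S} \<subseteq> {..card (pverts H)}"
    using assms(1) by (auto simp: zero_forcing_set_def card_mono)
  thus "finite {card S |S. zero_forcing_set H S}" using finite_subset by blast
qed (use assms in auto)


section \<open>Power domination in line digraphs\<close>

lemma power_domination_number_eqI:
  assumes "finite (pverts H)" "power_dominating_set H S" "card S = k"
    and "\<And>T. power_dominating_set H T \<Longrightarrow> k \<le> card T"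
  shows "power_domination_number H = k"
  unfolding power_domination_number_def
proof (rule Min_eqI)
  have "{card S |S. power_dominating_set H S} \<subseteq> {..card (pverts H)}"
    using assms(1) by (auto simp: power_dominating_set_def card_mono)
  thus "finite {card S |S. power_dominating_set H S}" using finite_subset by blast
qed (use assms in auto)

text \<open>
  Double counting. Let \<open>W\<close> be the set of vertices of \<open>G\<close> that are not the head of an arc in \<open>S\<close>.
  The arcs leaving \<open>v \<in> W\<close> are twins without an in-neighbour in \<open>S\<close>, so at least \<open>d - 1\<close> of them
  lie in \<open>S\<close>, whence \<open>(d - 1) * card W \<le> card S\<close>. But \<open>W\<close> is large: at most \<open>card S\<close> vertices are
  heads of arcs in \<open>S\<close>.
\<close>

lemma power_dominating_set_line_digraph_ge:
  assumes G: "diregular d G" and S: "power_dominating_set (line_digraph G) S"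
  shows "(d - 1) * card (pverts G) \<le> d * card S"
proof -
  let ?H = "line_digraph G"
  note fin = diregular_wf[OF G]
  have SV: "S \<subseteq> pverts ?H" using S by (simp add: power_dominating_set_def)
  have finH: "finite (pverts ?H)" using diregular_wf(1)[OF diregular_line_digraph[OF G]] .
  have finS: "finite S" using SV finH finite_subset by blast
  define W where "W = pverts G - arc_head ` S"
  define C where "C = {x \<in> pverts ?H. arc_tail x \<in> W}"
  have W: "W \<subseteq> pverts G" by (auto simp: W_def)
  have "inj_on arc_tail (C - S)"
  proof (rule inj_onI, rule ccontr)
    fix x y assume xy: "x \<in> C - S" "y \<in> C - S" "arc_tail x = arc_tail y" "x \<noteq> y"
    hence "in_nbrs ?H x \<inter> S \<noteq> {}"
      using power_dominating_set_meets_twins[OF S line_digraph_twins[of x G y] xy(4)]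
      by (auto simp: C_def)
    then obtain z where "z \<in> S" "arc_head z = arc_tail x"
      by (auto simp: in_nbrs_def in_parcs_line_digraph)
    thus False using xy by (force simp: C_def W_def)
  qed
  moreover have "arc_tail ` (C - S) \<subseteq> W" by (auto simp: C_def)
  ultimately have "card (C - S) \<le> card W"
    using card_inj_on_le finite_subset[OF W fin(1)] by blast
  moreover have "card C - card S \<le> card (C - S)" using diff_card_le_card_Diff[OF finS] .
  moreover have "card C = d * card W" using card_arcs_with_tail_in[OF G W] by (simp add: C_def)
  moreover have "card (pverts G) - card S \<le> card W"
  proof -
    have "card (pverts G) - card (arc_head ` S) \<le> card W"
      unfolding W_def using finS by (intro diff_card_le_card_Diff) simp
    moreover have "card (arc_head ` S) \<le> card S" using finS by (rule card_image_le)
    ultimately show ?thesis by linarith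
  qed
  ultimately have *: "d * card W \<le> card W + card S" "card (pverts G) \<le> card W + card S" by linarith+
  show ?thesis
  proof (cases d)
    case (Suc e)
    have "e * card (pverts G) \<le> e * card W + e * card S"
      using mult_le_mono2[OF *(2), of e] by (simp add: distrib_left)
    thus ?thesis using *(1) Suc by simp
  qed simp
qed

text \<open>
  The condition on all vertices is perfect total domination by \<open>U\<close>. Together with the condition on
  the vertices of \<open>U\<close> it says that \<open>U\<close> induces a disjoint union of directed cycles; this guarantees
  that all but one of the arcs leaving a given vertex of \<open>U\<close> leave the set \<open>U\<close> as well, so that no
  more than one arc per vertex remains to be forced.
\<close>

definition cyclic_perfect_dominating :: "'a pair_pre_digraph \<Rightarrow> 'a set \<Rightarrow> bool" where
  "cyclic_perfect_dominating G U \<longleftrightarrow> U \<subseteq> pverts G \<and>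
     (\<forall>v \<in> pverts G. \<exists>!u. u \<in> U \<and> (u, v) \<in> parcs G) \<and>
     (\<forall>u \<in> U. \<exists>!w. w \<in> U \<and> (u, w) \<in> parcs G)"

text \<open>
  Taking heads is a bijection from the arcs with tail in \<open>U\<close> to the vertices of \<open>G\<close>.
\<close>

lemma cyclic_perfect_dominating_card:
  fixes G :: "'a node pair_pre_digraph"
  assumes G: "diregular d G" and U: "cyclic_perfect_dominating G U"
  shows "d * card U = card (pverts G)"
proof -
  note fin = diregular_wf[OF G]
  let ?C = "{x \<in> pverts (line_digraph G). arc_tail x \<in> U}"
  have UV: "U \<subseteq> pverts G" using U by (simp add: cyclic_perfect_dominating_def)
  have ex: "\<exists>!u. u \<in> U \<and> (u, v) \<in> parcs G" if "v \<in> pverts G" for v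
    using U that by (simp add: cyclic_perfect_dominating_def)
  have "bij_betw arc_head ?C (pverts G)"
  proof (rule bij_betwI')
    fix x y assume xy: "x \<in> ?C" "y \<in> ?C"
    then obtain u v u' v' where "x = Arc u v" "(u, v) \<in> parcs G" "y = Arc u' v'" "(u', v') \<in> parcs G"
      "u \<in> U" "u' \<in> U" by (auto simp: in_pverts_line_digraph)
    moreover from this have "v \<in> pverts G" using fin(2) by auto
    ultimately show "arc_head x = arc_head y \<longleftrightarrow> x = y" using ex[of v]
      by (metis arc_head.simps(1))
  next
    fix v assume "v \<in> pverts G"
    then obtain u where "u \<in> U" "(u, v) \<in> parcs G" using ex by blast
    thus "\<exists>x \<in> ?C. v = arc_head x"
      by (intro bexI[of _ "Arc u v"]) (auto simp: in_pverts_line_digraph)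
  next
    fix x assume "x \<in> ?C"
    then obtain u v where "x = Arc u v" "(u, v) \<in> parcs G" by (auto simp: in_pverts_line_digraph)
    thus "arc_head x \<in> pverts G" using subsetD[OF fin(2)] by auto
  qed
  from bij_betw_same_card[OF this] show ?thesis using card_arcs_with_tail_in[OF G UV] by simp
qed

text \<open>
  This meets the double counting bound with equality: \<open>S\<close> contains \<open>d - 1\<close> of the arcs leaving each
  vertex of \<open>U\<close>, and each vertex outside \<open>U\<close> is the head of exactly one arc of \<open>S\<close>. The domination
  step therefore reaches every arc whose tail is outside \<open>U\<close>. What remains is one arc \<open>(a, b)\<close>
  inside \<open>U\<close> for each \<open>a \<in> U\<close>; since \<open>a\<close> has only one in-neighbour in \<open>U\<close>, some arc \<open>(w, a)\<close> with
  \<open>w\<close> outside \<open>U\<close> enters \<open>a\<close>, and it forces \<open>(a, b)\<close> in the second step.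
\<close>

lemma power_dominating_set_of_cyclic_perfect:
  assumes G: "diregular d G" and d: "d \<ge> 2" and ne: "pverts G \<noteq> {}"
    and U: "cyclic_perfect_dominating G U" and nl: "\<not> has_loop G"
  defines "S \<equiv> {x \<in> pverts (line_digraph G). arc_tail x \<in> U \<and> arc_head x \<notin> U}"
  shows "power_dominating_set (line_digraph G) S" "card S = (d - 1) * card U"
proof -
  let ?H = "line_digraph G"
  note fin = diregular_wf[OF G]
  have UV: "U \<subseteq> pverts G" using U by (simp add: cyclic_perfect_dominating_def)
  have pre: "\<exists>!u. u \<in> U \<and> (u, v) \<in> parcs G" if "v \<in> pverts G" for v
    using U that by (simp add: cyclic_perfect_dominating_def)
  have post: "\<exists>!w. w \<in> U \<and> (u, w) \<in> parcs G" if "u \<in> U" for u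
    using U that by (simp add: cyclic_perfect_dominating_def)
  have sub: "S \<subseteq> pverts ?H" by (auto simp: S_def)
  have "bij_betw arc_head S (pverts G - U)"
  proof (rule bij_betwI')
    fix x y assume xy: "x \<in> S" "y \<in> S"
    then obtain u v u' v' where "x = Arc u v" "(u, v) \<in> parcs G" "y = Arc u' v'" "(u', v') \<in> parcs G"
      "u \<in> U" "u' \<in> U" by (auto simp: S_def in_pverts_line_digraph)
    moreover from this have "v \<in> pverts G" using fin(2) by auto
    ultimately show "arc_head x = arc_head y \<longleftrightarrow> x = y" using pre[of v]
      by (metis arc_head.simps(1))
  next
    fix v assume v: "v \<in> pverts G - U"
    then obtain u where "u \<in> U" "(u, v) \<in> parcs G" using pre by blast
    thus "\<exists>x \<in> S. v = arc_head x"
      using v by (intro bexI[of _ "Arc u v"]) (auto simp: S_def in_pverts_line_digraph)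
  next
    fix x assume "x \<in> S"
    then obtain u v where "x = Arc u v" "(u, v) \<in> parcs G" "v \<notin> U"
      by (auto simp: S_def in_pverts_line_digraph)
    thus "arc_head x \<in> pverts G - U" using subsetD[OF fin(2)] by auto
  qed
  hence "card S = card (pverts G) - card U"
    using bij_betw_same_card UV fin(1) by (metis card_Diff_subset finite_subset)
  thus card: "card S = (d - 1) * card U"
    by (simp add: cyclic_perfect_dominating_card[OF G U, symmetric] diff_mult_distrib)
  have "card U > 0" using cyclic_perfect_dominating_card[OF G U] ne fin(1)
    by (metis card_gt_0_iff mult_0_right neq0_conv)
  hence "card S > 0" using d card by simp
  hence "S \<noteq> {}" by auto
  define P where "P = closed_out_nbrs ?H S"
  have P_sub: "P \<subseteq> pverts ?H"
    using sub by (auto simp: P_def closed_out_nbrs_def out_nbrs_def in_parcs_line_digraph)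
  have S_P: "S \<subseteq> P" by (auto simp: P_def closed_out_nbrs_def)
  have out_P: "Arc v x \<in> P" if v: "v \<notin> U" and a: "(v, x) \<in> parcs G" for v x
  proof -
    obtain u where "u \<in> U" "(u, v) \<in> parcs G" using pre[of v] a fin(2) by blast
    hence "Arc u v \<in> S" "Arc v x \<in> out_nbrs ?H (Arc u v)"
      using v a by (auto simp: S_def in_pverts_line_digraph out_nbrs_def in_parcs_line_digraph)
    thus ?thesis by (auto simp: P_def closed_out_nbrs_def)
  qed
  have "x \<in> force_step ?H P" if x: "x \<in> pverts ?H" "x \<notin> P" for x
  proof -
    obtain a b where ab: "x = Arc a b" "(a, b) \<in> parcs G"
      using x by (auto simp: in_pverts_line_digraph)
    have aU: "a \<in> U" using out_P ab x by blast
    moreover have bU: "b \<in> U" using S_P aU ab x by (auto simp: S_def)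
    ultimately obtain w where w: "(w, a) \<in> parcs G" "w \<notin> U"
      using in_nbr_other_than[OF G d, of a "\<lambda>u. u \<in> U"] UV pre[of a]
      by (metis (mono_tags, lifting) in_nbrs_def mem_Collect_eq subsetD)
    have "Arc w a \<in> P" using out_P w by blast
    moreover have "out_nbrs ?H (Arc w a) - P = {x}"
    proof -
      have "Arc a c \<in> P" if c: "(a, c) \<in> parcs G" "c \<noteq> b" for c
      proof -
        have "c \<notin> U" using post[OF aU] bU ab c by blast
        thus ?thesis using S_P aU c by (auto simp: S_def in_pverts_line_digraph)
      qed
      moreover have "out_nbrs ?H (Arc w a) = Arc a ` out_nbrs G a"
        by (rule out_nbrs_line_digraph[OF w(1)])
      ultimately show ?thesis using x ab by (auto simp: out_nbrs_def[of G])
    qed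
    ultimately show ?thesis
      using x has_loop_line_digraph[OF fin(2) nl] by (auto simp: force_step_def)
  qed
  hence "force_step ?H P = pverts ?H" using P_sub by (auto simp: force_step_def split: if_splits)
  hence "monitored ?H S 2 = pverts ?H" by (simp add: numeral_2_eq_2 P_def)
  thus "power_dominating_set ?H S"
    using sub \<open>S \<noteq> {}\<close> unfolding power_dominating_set_def by blast
qed

text \<open>
  The arcs of a one-factor of \<open>G\<close>: the one that precedes an arc \<open>(a, b)\<close> is the unique one entering
  \<open>a\<close>, and the successor of \<open>(v, \<phi> v)\<close> among them is \<open>(\<phi> v, \<phi> (\<phi> v))\<close>.
\<close>

lemma cyclic_perfect_dominating_line_digraph:
  assumes G: "diregular d G" and \<phi>: "one_factor G \<phi>"
  shows "cyclic_perfect_dominating (line_digraph G) ((\<lambda>v. Arc v (\<phi> v)) ` pverts G)"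
proof -
  note fin = diregular_wf[OF G]
  have arc: "(v, \<phi> v) \<in> parcs G" if "v \<in> pverts G" for v using \<phi> that by (auto simp: one_factor_def)
  have bij: "\<exists>!u. u \<in> pverts G \<and> \<phi> u = v" if "v \<in> pverts G" for v
  proof -
    have "v \<in> \<phi> ` pverts G" and inj: "inj_on \<phi> (pverts G)"
      using \<phi> that by (simp_all add: one_factor_def bij_betw_def)
    then obtain u where "u \<in> pverts G" "\<phi> u = v" by auto
    thus ?thesis using inj by (blast dest: inj_onD)
  qed
  have im: "\<phi> v \<in> pverts G" if "v \<in> pverts G" for v using arc[OF that] fin(2) by auto
  show ?thesis
    unfolding cyclic_perfect_dominating_def
  proof (intro conjI ballI)
    show "(\<lambda>v. Arc v (\<phi> v)) ` pverts G \<subseteq> pverts (line_digraph G)"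
      using arc by (auto simp: in_pverts_line_digraph)
  next
    fix x assume "x \<in> pverts (line_digraph G)"
    then obtain a b where x: "x = Arc a b" "(a, b) \<in> parcs G" by (auto simp: in_pverts_line_digraph)
    hence "a \<in> pverts G" using fin(2) by auto
    from bij[OF this] obtain v where v: "v \<in> pverts G" "\<phi> v = a"
      and uniq: "\<And>u. u \<in> pverts G \<Longrightarrow> \<phi> u = a \<Longrightarrow> u = v" by blast
    have "y = Arc v a" if "y \<in> (\<lambda>v. Arc v (\<phi> v)) ` pverts G" "(y, x) \<in> parcs (line_digraph G)" for y
      using that x uniq by (auto simp: in_parcs_line_digraph)
    moreover have "Arc v a \<in> (\<lambda>v. Arc v (\<phi> v)) ` pverts G" using v by auto
    moreover have "(Arc v a, x) \<in> parcs (line_digraph G)"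
      using x arc[OF v(1)] v(2) by (auto simp: in_parcs_line_digraph in_pverts_line_digraph)
    ultimately show "\<exists>!y. y \<in> (\<lambda>v. Arc v (\<phi> v)) ` pverts G \<and> (y, x) \<in> parcs (line_digraph G)"
      by blast
  next
    fix x assume "x \<in> (\<lambda>v. Arc v (\<phi> v)) ` pverts G"
    then obtain v where x: "x = Arc v (\<phi> v)" "v \<in> pverts G" by auto
    show "\<exists>!y. y \<in> (\<lambda>v. Arc v (\<phi> v)) ` pverts G \<and> (x, y) \<in> parcs (line_digraph G)"
      using x arc im by (intro ex1I[of _ "Arc (\<phi> v) (\<phi> (\<phi> v))"])
        (auto simp: in_parcs_line_digraph in_pverts_line_digraph)
  qed
qed


section \<open>The parameters of a line digraph\<close>

text \<open>
  In the adjacency matrix of a line digraph the column of an arc is determined by the tail of that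
  arc, so there are at most \<open>card (pverts G)\<close> different columns.
\<close>

lemma low_rank_matrix_line_digraph:
  assumes G: "diregular d G"
  shows "\<exists>X \<in> digraph_matrices (line_digraph G).
    vec_space.rank (card (pverts (line_digraph G))) X \<le> card (pverts G)"
proof -
  define H where "H = line_digraph G"
  define p where "p = card (pverts H)"
  define f where "f = vertex_numbering H"
  note fin = diregular_wf[OF G]
  have finH: "finite (pverts H)"
    using diregular_wf(1)[OF diregular_line_digraph[OF G]] by (simp add: H_def)
  have f: "f j \<in> pverts H" if "j < p" for j
    using bij_vertex_numbering[OF finH] that by (auto simp: bij_betw_def f_def p_def)
  define X :: "real mat" where
    "X = mat p p (\<lambda>(i, j). if (f i, f j) \<in> parcs H then 1 else 0)"
  have X: "X \<in> carrier_mat p p" by (simp add: X_def)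
  have XH: "X \<in> digraph_matrices H"
    by (auto simp: digraph_matrices_def X_def Let_def p_def f_def)
  \<comment> \<open>The common column of all arcs with tail \<open>v\<close>.\<close>
  define c :: "'a node \<Rightarrow> real vec" where
    "c = (\<lambda>v. vec p (\<lambda>i. if arc_head (f i) = v then 1 else 0))"
  have "col X j = c (arc_tail (f j))" "arc_tail (f j) \<in> pverts G" if j: "j < p" for j
  proof -
    show "col X j = c (arc_tail (f j))"
      using j f by (auto simp: X_def c_def H_def in_parcs_line_digraph intro!: eq_vecI)
    show "arc_tail (f j) \<in> pverts G"
      using f[OF j] fin(2) by (auto simp: H_def in_pverts_line_digraph)
  qed
  hence "set (cols X) \<subseteq> c ` pverts G" using X by (auto simp: cols_def)
  hence "card (set (cols X)) \<le> card (pverts G)"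
    using fin(1) by (rule surj_card_le[rotated])
  hence "vec_space.rank p X \<le> card (pverts G)" using rank_le_card_cols[OF X] by linarith
  thus ?thesis using XH by (auto simp: H_def p_def)
qed

lemma line_digraph_parameters:
  assumes G: "diregular d G" and d: "d \<ge> 2" and ne: "pverts G \<noteq> {}" and nl: "\<not> has_loop G"
    and \<phi>: "one_factor G \<phi>"
  shows "zero_forcing_number (line_digraph G) = (d - 1) * card (pverts G)"
    "max_nullity (line_digraph G) = (d - 1) * card (pverts G)"
    "min_rank (line_digraph G) = card (pverts G)"
proof -
  let ?H = "line_digraph G"
  note finH = diregular_wf[OF diregular_line_digraph[OF G]]
  obtain S where S: "zero_forcing_set ?H S" "card S = (d - 1) * card (pverts G)"
    using zero_forcing_set_of_one_factor[OF G d ne \<phi> nl] by blast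
  show "zero_forcing_number ?H = (d - 1) * card (pverts G)"
    using zero_forcing_number_eqI[OF finH(1) S] zero_forcing_set_line_digraph_ge[OF G] by blast
  have "card (pverts ?H) = card S + card (pverts G)"
    using d by (cases d) (simp_all add: card_pverts_line_digraph[OF G] S(2))
  then show "max_nullity ?H = (d - 1) * card (pverts G)" "min_rank ?H = card (pverts G)"
    using low_rank_matrix_line_digraph[OF G]
      min_rank_and_max_nullity_eqI[OF finH(1) S(1)] S(2) by metis+
qed

lemma power_domination_number_line_digraph:
  assumes G: "diregular d G" and d: "d \<ge> 2" and ne: "pverts G \<noteq> {}" and nl: "\<not> has_loop G"
    and U: "cyclic_perfect_dominating G U"
  shows "power_domination_number (line_digraph G) = (d - 1) * card U"
proof (rule power_domination_number_eqI)
  show "finite (pverts (line_digraph G))"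
    by (rule diregular_wf(1)[OF diregular_line_digraph[OF G]])
  fix T assume "power_dominating_set (line_digraph G) T"
  hence "(d - 1) * (d * card U) \<le> d * card T"
    using power_dominating_set_line_digraph_ge[OF G] cyclic_perfect_dominating_card[OF G U] by simp
  hence "d * ((d - 1) * card U) \<le> d * card T" by (simp add: mult.left_commute)
  thus "(d - 1) * card U \<le> card T" using d by simp
qed (use power_dominating_set_of_cyclic_perfect[OF G d ne U nl] in auto)


section \<open>The wrapped butterfly\<close>

abbreviation butterfly_base :: "nat \<Rightarrow> nat \<Rightarrow> (nat \<times> nat) node pair_pre_digraph" where
  "butterfly_base d n \<equiv>
     embed_digraph (conjunction (complete_looped_digraph d) (directed_cycle n))"

lemma pverts_butterfly_base: "pverts (butterfly_base d n) = Base ` ({..<d} \<times> {..<n})"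
  by (simp add: embed_digraph_def conjunction_def complete_looped_digraph_def directed_cycle_def)

lemma parcs_butterfly_base:
  "(x, y) \<in> parcs (butterfly_base d n) \<longleftrightarrow>
     (\<exists>a b i. a < d \<and> b < d \<and> i < n \<and> x = Base (a, i) \<and> y = Base (b, Suc i mod n))"
  by (auto simp: embed_digraph_def conjunction_def complete_looped_digraph_def directed_cycle_def)

lemma ex_cyclic_predecessor:
  assumes "j < n"
  shows "\<exists>p<n. \<forall>i<n. Suc i mod n = j \<longleftrightarrow> i = p"
proof (intro exI conjI allI impI)
  show "(if j = 0 then n - 1 else j - 1) < n" using assms by auto
  fix i assume "i < n"
  thus "Suc i mod n = j \<longleftrightarrow> i = (if j = 0 then n - 1 else j - 1)"
    using assms by (cases "Suc i = n") auto
qed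

lemma diregular_butterfly_base: "diregular d (butterfly_base d n)"
  unfolding diregular_def
proof (intro conjI ballI)
  show "finite (pverts (butterfly_base d n))" by (simp add: pverts_butterfly_base)
  show "parcs (butterfly_base d n) \<subseteq> pverts (butterfly_base d n) \<times> pverts (butterfly_base d n)"
    by (auto simp: pverts_butterfly_base parcs_butterfly_base)
  fix x assume "x \<in> pverts (butterfly_base d n)"
  then obtain a j where x: "x = Base (a, j)" "a < d" "j < n" by (auto simp: pverts_butterfly_base)
  have "out_nbrs (butterfly_base d n) x = (\<lambda>b. Base (b, Suc j mod n)) ` {..<d}"
    using x by (auto simp: out_nbrs_def parcs_butterfly_base)
  thus "card (out_nbrs (butterfly_base d n) x) = d" by (simp add: card_image inj_on_def)
  obtain p where p: "p < n" "\<And>i. i < n \<Longrightarrow> Suc i mod n = j \<longleftrightarrow> i = p"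
    using ex_cyclic_predecessor[OF x(3)] by blast
  have "in_nbrs (butterfly_base d n) x = (\<lambda>b. Base (b, p)) ` {..<d}"
    using x p by (fastforce simp: in_nbrs_def parcs_butterfly_base)
  thus "card (in_nbrs (butterfly_base d n) x) = d" by (simp add: card_image inj_on_def)
qed

lemma butterfly_base_loopless:
  assumes "n \<ge> 2" shows "\<not> has_loop (butterfly_base d n)"
proof -
  have "Suc i mod n \<noteq> i" if "i < n" for i using that assms by (cases "Suc i = n") auto
  thus ?thesis by (fastforce simp: has_loop_def parcs_butterfly_base)
qed

lemma Suc_mod_inj: "i < n \<Longrightarrow> j < n \<Longrightarrow> Suc i mod n = Suc j mod n \<Longrightarrow> i = j"
  by (cases "Suc i = n"; cases "Suc j = n") auto

lemma one_factor_butterfly_base: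
  "\<exists>\<phi>. one_factor (butterfly_base d n) \<phi>"
proof
  let ?\<phi> = "\<lambda>x. case x of Base (a, i) \<Rightarrow> Base (a, Suc i mod n) | Arc u v \<Rightarrow> Arc u v"
  let ?V = "pverts (butterfly_base d n)"
  have "inj_on ?\<phi> ?V" by (auto simp: pverts_butterfly_base inj_on_def dest: Suc_mod_inj)
  moreover have "?\<phi> ` ?V \<subseteq> ?V" by (auto simp: pverts_butterfly_base)
  moreover have "finite ?V" by (simp add: pverts_butterfly_base)
  ultimately have "bij_betw ?\<phi> ?V ?V" by (simp add: bij_betw_def endo_inj_surj)
  thus "one_factor (butterfly_base d n) ?\<phi>"
    by (auto simp: one_factor_def pverts_butterfly_base parcs_butterfly_base)
qed

text \<open>
  Iterated line digraphs get such a set from a one-factor of the digraph before; at the start of the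
  iteration the copy of the cycle \<open>C\<^sub>n\<close> on the vertices \<open>(0, i)\<close> serves.
\<close>

lemma cyclic_perfect_dominating_butterfly_base:
  assumes "d \<ge> 1"
  shows "cyclic_perfect_dominating (butterfly_base d n) ((\<lambda>i. Base (0, i)) ` {..<n})"
  unfolding cyclic_perfect_dominating_def
proof (intro conjI ballI)
  show "(\<lambda>i. Base (0, i)) ` {..<n} \<subseteq> pverts (butterfly_base d n)"
    using assms by (auto simp: pverts_butterfly_base)
next
  fix x assume "x \<in> pverts (butterfly_base d n)"
  then obtain a j where x: "x = Base (a, j)" "a < d" "j < n" by (auto simp: pverts_butterfly_base)
  obtain p where p: "p < n" "\<And>i. i < n \<Longrightarrow> Suc i mod n = j \<longleftrightarrow> i = p"
    using ex_cyclic_predecessor[OF x(3)] by blast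
  show "\<exists>!u. u \<in> (\<lambda>i. Base (0, i)) ` {..<n} \<and> (u, x) \<in> parcs (butterfly_base d n)"
    using x assms p by (intro ex1I[of _ "Base (0, p)"]) (fastforce simp: parcs_butterfly_base)+
next
  fix u :: "(nat \<times> nat) node" assume "u \<in> (\<lambda>i. Base (0, i)) ` {..<n}"
  thus "\<exists>!w. w \<in> (\<lambda>i. Base (0, i)) ` {..<n} \<and> (u, w) \<in> parcs (butterfly_base d n)"
    using assms by (auto simp: parcs_butterfly_base)
qed

lemma iterated_line_digraph:
  assumes "n \<ge> 2"
  shows "diregular d ((line_digraph ^^ k) (butterfly_base d n)) \<and>
    \<not> has_loop ((line_digraph ^^ k) (butterfly_base d n)) \<and>
    card (pverts ((line_digraph ^^ k) (butterfly_base d n))) = d ^ Suc k * n \<and>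
    (\<exists>\<phi>. one_factor ((line_digraph ^^ k) (butterfly_base d n)) \<phi>)"
proof (induction k)
  case 0
  have "card (pverts (butterfly_base d n)) = d * n"
    by (simp add: pverts_butterfly_base card_image inj_on_def card_cartesian_product)
  thus ?case
    using diregular_butterfly_base butterfly_base_loopless[OF assms] one_factor_butterfly_base
    by simp
next
  case (Suc k)
  define G where "G = (line_digraph ^^ k) (butterfly_base d n)"
  have G: "diregular d G" "\<not> has_loop G" "card (pverts G) = d ^ Suc k * n"
    using Suc.IH by (auto simp: G_def)
  have eq: "(line_digraph ^^ Suc k) (butterfly_base d n) = line_digraph G" by (simp add: G_def)
  show ?case
    unfolding eq
    using diregular_line_digraph[OF G(1)] has_loop_line_digraph[OF diregular_wf(2)[OF G(1)] G(2)]
      card_pverts_line_digraph[OF G(1)] one_factor_line_digraph[OF G(1)] G(3)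
    by simp
qed

lemma ex_cyclic_perfect_dominating_iterated:
  assumes "n \<ge> 2" "d \<ge> 1"
  shows "\<exists>U. cyclic_perfect_dominating ((line_digraph ^^ k) (butterfly_base d n)) U"
proof (cases k)
  case 0
  thus ?thesis using cyclic_perfect_dominating_butterfly_base[OF assms(2)] by auto
next
  case (Suc m)
  thus ?thesis
    using iterated_line_digraph[OF assms(1), of d m] cyclic_perfect_dominating_line_digraph by auto
qed

theorem corollary5p5:
  fixes d n :: nat
  assumes "d \<ge> 2" and "n \<ge> 2"
  shows "zero_forcing_number (wrapped_butterfly d n) = (d - 1) * d ^ (n - 1) * n \<and>
         max_nullity (wrapped_butterfly d n) = (d - 1) * d ^ (n - 1) * n \<and>
         min_rank (wrapped_butterfly d n) = d ^ (n - 1) * n \<and>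
         power_domination_number (wrapped_butterfly d n) = (d - 1) * d ^ (n - 2) * n"
proof -
  define G where "G = (line_digraph ^^ (n - 2)) (butterfly_base d n)"
  have n: "n - 1 = Suc (n - 2)" using assms by simp
  have WB: "wrapped_butterfly d n = line_digraph G"
    unfolding wrapped_butterfly_def n G_def by simp
  obtain \<phi> where G: "diregular d G" "\<not> has_loop G" "one_factor G \<phi>"
    and card: "card (pverts G) = d ^ (n - 1) * n"
    using iterated_line_digraph[OF assms(2), of d "n - 2"] unfolding G_def[symmetric] n by blast
  have "card (pverts G) > 0" using card assms by simp
  hence ne: "pverts G \<noteq> {}" by auto
  obtain U where U: "cyclic_perfect_dominating G U"
    using ex_cyclic_perfect_dominating_iterated[OF assms(2), of d "n - 2"] assms by (auto simp: G_def)
  have "d * card U = d * (d ^ (n - 2) * n)"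
    using cyclic_perfect_dominating_card[OF G(1) U] card unfolding n by (simp only: power_Suc mult.assoc)
  hence cardU: "card U = d ^ (n - 2) * n" using assms by simp
  thus ?thesis
    using line_digraph_parameters[OF G(1) assms(1) ne G(2,3)]
      power_domination_number_line_digraph[OF G(1) assms(1) ne G(2) U]
    by (simp add: WB card cardU mult.assoc)
qed

end
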